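(* Let $K$ be a field, $n\ge2$, and $R=R(K[X_1,\ldots,X_n])$. Then $R$ is not a unique factorization domain.
   Context: For an integral domain $T$, the reciprocal complement $R(T)$ is the subring of the fraction field of $T$ generated by all $1/f$ with $f\in T\setminus\{0\}$. Here $K[X_1,\ldots,X_n]$ is the polynomial ring in $n$ variables over $K$. *)

theory Defs
  imports
    "HOL-Library.Poly_Mapping"
    "HOL-Library.Cardinality"
    "HOL-Computational_Algebra.Fraction_Field"
    "HOL-Algebra.Generated_Rings"
    "HOL-Algebra.Ring_Divisibility"
    "HOL-Algebra.Algebraic_Closure_Type"
begin

text \<open>
  Polynomials over \<open>'k\<close> in variables indexed by \<open>'n\<close>: finitely supported maps from exponent
  vectors to coefficients, with the convolution product. For finite \<open>'n\<close> the number of variables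
  is \<open>CARD('n)\<close>. The library's \<open>idom\<close> instance needs a linear order on \<open>'n\<close>; it does not enter
  the ring operations, and every finite cardinality is realised by a linearly ordered type.
\<close>

type_synonym ('n, 'k) mpoly = "('n \<Rightarrow>\<^sub>0 nat) \<Rightarrow>\<^sub>0 'k"

text \<open>The domain $T$ is the whole type \<open>'t\<close>, and its fraction field is \<open>'t fract\<close>.\<close>

definition reciprocal_complement :: "'t::idom fract ring" where
  "reciprocal_complement =
     ring_of_type_algebra
       \<lparr>carrier := generate_ring ring_of_type_algebra {Fract 1 f | f :: 't. f \<noteq> 0}\<rparr>"

lemma domain_reciprocal_complement:
  "domain (reciprocal_complement :: 't::idom fract ring)"
proof -
  let ?F = "ring_of_type_algebra :: 't fract ring"
  interpret F: field ?F by (rule field_from_type_algebra)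
  have "subring (generate_ring ?F {Fract 1 f | f :: 't. f \<noteq> 0}) ?F"
    by (rule F.generate_ring_is_subring) (simp add: ring_of_type_algebra_def)
  then show ?thesis
    unfolding reciprocal_complement_def by (rule F.subring_is_domain)
qed

end

theory Submission
  imports Defs "HOL-Computational_Algebra.Polynomial"
begin

text \<open>
  Products of reciprocals are reciprocals, so the elements of \<open>R\<close> are the finite sums
  \<open>1/f\<^sub>1 + \<dots> + 1/f\<^sub>k\<close>. Collecting the constant \<open>f\<^sub>i\<close>, each of them is a constant \<open>c\<close> plus
  reciprocals of polynomials of positive degree. The total degree orders the fraction field at
  infinity: \<open>a/b\<close> has order \<open>deg b - deg a\<close>. Reciprocals of nonconstant polynomials, hence also
  their sums, have order at least \<open>1\<close>.

  The one fact with some depth is that \<open>R\<close> is local in the following sense: an element with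
  \<open>c \<noteq> 0\<close> is a unit (lemma \<open>inverse_mem_reciprocals\<close>). Consequently every nonunit has order at
  least \<open>1\<close>, a product of two nonunits has order at least \<open>2\<close>, and the reciprocal of any
  polynomial of degree \<open>1\<close> is irreducible (lemma \<open>reciprocal_linear_irreducible\<close>).

  For two different variables \<open>x\<close>, \<open>y\<close> look at the identity
  \<open>1/x * 1/y = 1/(x + y) * (1/x + 1/y)\<close>. If \<open>R\<close> were factorial, the irreducible \<open>1/(x + y)\<close>
  would be prime and divide \<open>1/x\<close>, say, so that \<open>(x + y)/x\<close> would be in \<open>R\<close>. It would then differ
  from some constant \<open>c\<close> by an element of order at least \<open>1\<close>; but the difference is
  \<open>((1 - c) x + y)/x\<close>, of order \<open>0\<close>.
\<close>

section \<open>Sums of reciprocals\<close>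

abbreviation reciprocals :: "'t::idom fract set" where
  "reciprocals \<equiv> carrier reciprocal_complement"

lemma carrier_reciprocal_complement:
  "(reciprocals :: 't::idom fract set) =
     generate_ring ring_of_type_algebra {Fract 1 f | f :: 't. f \<noteq> 0}"
  by (simp add: reciprocal_complement_def)

lemma reciprocal_complement_simps [simp]:
  "\<one>\<^bsub>reciprocal_complement\<^esub> = (1 :: 't::idom fract)"
  "\<zero>\<^bsub>reciprocal_complement\<^esub> = (0 :: 't fract)"
  "(x :: 't fract) \<otimes>\<^bsub>reciprocal_complement\<^esub> y = x * y"
  by (simp_all add: reciprocal_complement_def ring_of_type_algebra_def)

lemma a_inv_ring_of_type_algebra:
  "\<ominus>\<^bsub>ring_of_type_algebra\<^esub> (x :: 'f::field) = - x"
proof -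
  interpret field "ring_of_type_algebra :: 'f ring" by (rule field_from_type_algebra)
  show ?thesis
    by (rule minus_equality) (simp_all add: ring_of_type_algebra_def)
qed

lemma Fract_mem_reciprocals: "f \<noteq> 0 \<Longrightarrow> Fract 1 f \<in> reciprocals"
  unfolding carrier_reciprocal_complement by (rule generate_ring.incl) auto

lemma one_mem_reciprocals: "1 \<in> reciprocals"
  using generate_ring.one[of "ring_of_type_algebra :: 'a fract ring"]
  by (simp add: carrier_reciprocal_complement ring_of_type_algebra_def)

lemma uminus_mem_reciprocals: "x \<in> reciprocals \<Longrightarrow> - x \<in> reciprocals"
  using generate_ring.a_inv[of x ring_of_type_algebra]
  by (simp add: carrier_reciprocal_complement a_inv_ring_of_type_algebra)

lemma add_mem_reciprocals: "x \<in> reciprocals \<Longrightarrow> y \<in> reciprocals \<Longrightarrow> x + y \<in> reciprocals"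
  using generate_ring.eng_add[of x ring_of_type_algebra _ y]
  by (simp add: carrier_reciprocal_complement ring_of_type_algebra_def)

lemma mult_mem_reciprocals: "x \<in> reciprocals \<Longrightarrow> y \<in> reciprocals \<Longrightarrow> x * y \<in> reciprocals"
  using generate_ring.eng_mult[of x ring_of_type_algebra _ y]
  by (simp add: carrier_reciprocal_complement ring_of_type_algebra_def)

lemma zero_mem_reciprocals: "0 \<in> reciprocals"
  using add_mem_reciprocals[OF one_mem_reciprocals uminus_mem_reciprocals[OF one_mem_reciprocals]]
  by simp

lemmas reciprocals_closed =
  zero_mem_reciprocals one_mem_reciprocals uminus_mem_reciprocals
  add_mem_reciprocals mult_mem_reciprocals Fract_mem_reciprocals

lemma sum_mem_reciprocals:
  "(\<And>i. i \<in> I \<Longrightarrow> h i \<in> reciprocals) \<Longrightarrow> sum h I \<in> reciprocals"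
  by (induction I rule: infinite_finite_induct) (auto intro: reciprocals_closed)

lemma power_mem_reciprocals: "x \<in> reciprocals \<Longrightarrow> x ^ n \<in> reciprocals"
  by (induction n) (auto intro: reciprocals_closed)

lemma of_nat_mem_reciprocals: "of_nat n \<in> reciprocals"
  by (induction n) (auto intro: reciprocals_closed)

lemma reciprocals_eq_sum_list:
  fixes r :: "'t::idom fract"
  assumes "r \<in> reciprocals"
  shows "\<exists>fs. 0 \<notin> set fs \<and> r = (\<Sum>f\<leftarrow>fs. Fract 1 f)"
  using assms unfolding carrier_reciprocal_complement
proof (induction rule: generate_ring.induct)
  case one
  show ?case
    by (intro exI[of _ "[1]"]) (simp add: ring_of_type_algebra_def One_fract_def)
next
  case (incl h)
  then obtain f where "h = Fract 1 f" "f \<noteq> 0" by blast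
  then show ?case by (intro exI[of _ "[f]"]) simp
next
  case (a_inv h)
  then obtain fs where fs: "0 \<notin> set fs" "h = (\<Sum>f\<leftarrow>fs. Fract 1 f)" by blast
  have "- (\<Sum>f\<leftarrow>fs. Fract 1 f) = (\<Sum>f\<leftarrow>map uminus fs. Fract 1 f)"
  proof (induction fs)
    case (Cons f fs)
    have "- Fract 1 f = Fract 1 (- f)"
      by (metis minus_fract minus_fract_cancel minus_minus)
    with Cons show ?case by simp
  qed simp
  with fs show ?case
    by (intro exI[of _ "map uminus fs"]) (auto simp: a_inv_ring_of_type_algebra)
next
  case (eng_add h1 h2)
  then obtain fs gs where "0 \<notin> set fs" "h1 = (\<Sum>f\<leftarrow>fs. Fract 1 f)"
    "0 \<notin> set gs" "h2 = (\<Sum>f\<leftarrow>gs. Fract 1 f)" by blast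
  then show ?case
    by (intro exI[of _ "fs @ gs"]) (auto simp: ring_of_type_algebra_def)
next
  case (eng_mult h1 h2)
  then obtain fs gs where fs: "0 \<notin> set fs" "h1 = (\<Sum>f\<leftarrow>fs. Fract 1 f)"
    and gs: "0 \<notin> set gs" "h2 = (\<Sum>f\<leftarrow>gs. Fract 1 f)" by blast
  have "(\<Sum>f\<leftarrow>fs. Fract 1 f) * (\<Sum>f\<leftarrow>gs. Fract 1 f)
          = (\<Sum>f\<leftarrow>concat (map (\<lambda>f. map ((*) f) gs) fs). Fract 1 f)"
  proof (induction fs)
    case (Cons f fs)
    have "Fract 1 f * (\<Sum>g\<leftarrow>gs. Fract 1 g) = (\<Sum>g\<leftarrow>map ((*) f) gs. Fract 1 g)"
      by (simp add: sum_list_const_mult[symmetric] o_def)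
    with Cons show ?case by (simp add: algebra_simps)
  qed simp
  with fs gs show ?case
    by (intro exI[of _ "concat (map (\<lambda>f. map ((*) f) gs) fs)"])
      (auto simp: ring_of_type_algebra_def)
qed

section \<open>Inverting a sum of reciprocals\<close>

text \<open>
  The radical, inside the ring of sums of reciprocals, of the ideal of multiples of \<open>\<alpha>\<close>;
  membership of \<open>1\<close> in it says that \<open>\<alpha>\<close> is invertible.
\<close>

definition radical_of :: "'t::idom fract \<Rightarrow> 't fract set" where
  "radical_of \<alpha> = {r \<in> reciprocals. \<exists>n. r ^ n * inverse \<alpha> \<in> reciprocals}"

text \<open>
  In the binomial expansion of \<open>(r + s) ^ (m + n)\<close> every term contains \<open>r ^ m\<close> or \<open>s ^ n\<close>.
\<close>

lemma radical_of_add: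
  assumes "r \<in> radical_of \<alpha>" "s \<in> radical_of \<alpha>"
  shows "r + s \<in> radical_of \<alpha>"
proof -
  from assms obtain m n where rs: "r \<in> reciprocals" "s \<in> reciprocals"
    and m: "r ^ m * inverse \<alpha> \<in> reciprocals" and n: "s ^ n * inverse \<alpha> \<in> reciprocals"
    by (auto simp: radical_of_def)
  have summand: "of_nat (m + n choose k) * r ^ k * s ^ (m + n - k) * inverse \<alpha> \<in> reciprocals"
    if "k \<le> m + n" for k
  proof (cases "m \<le> k")
    case True
    then have "r ^ k = r ^ (k - m) * r ^ m" by (simp flip: power_add)
    then have "of_nat (m + n choose k) * r ^ k * s ^ (m + n - k) * inverse \<alpha>
        = (of_nat (m + n choose k) * r ^ (k - m) * s ^ (m + n - k)) * (r ^ m * inverse \<alpha>)"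
      by (simp add: mult_ac)
    then show ?thesis
      using m rs
      by (auto simp only: intro!: mult_mem_reciprocals power_mem_reciprocals of_nat_mem_reciprocals)
  next
    case False
    then have "s ^ (m + n - k) = s ^ (m - k) * s ^ n" by (simp flip: power_add)
    then have "of_nat (m + n choose k) * r ^ k * s ^ (m + n - k) * inverse \<alpha>
        = (of_nat (m + n choose k) * r ^ k * s ^ (m - k)) * (s ^ n * inverse \<alpha>)"
      by (simp add: mult_ac)
    then show ?thesis
      using n rs
      by (auto simp only: intro!: mult_mem_reciprocals power_mem_reciprocals of_nat_mem_reciprocals)
  qed
  have "(r + s) ^ (m + n) * inverse \<alpha>
      = (\<Sum>k\<le>m + n. of_nat (m + n choose k) * r ^ k * s ^ (m + n - k) * inverse \<alpha>)"
    by (simp add: binomial_ring sum_distrib_right)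
  also have "\<dots> \<in> reciprocals"
    by (rule sum_mem_reciprocals) (use summand in simp)
  finally show ?thesis
    using rs by (auto simp: radical_of_def intro: reciprocals_closed)
qed

lemma radical_of_mult:
  assumes "r \<in> radical_of \<alpha>" "u \<in> reciprocals"
  shows "u * r \<in> radical_of \<alpha>"
proof -
  from assms obtain n where r: "r \<in> reciprocals" and n: "r ^ n * inverse \<alpha> \<in> reciprocals"
    by (auto simp: radical_of_def)
  have "(u * r) ^ n * inverse \<alpha> = u ^ n * (r ^ n * inverse \<alpha>)"
    by (simp add: power_mult_distrib)
  also have "\<dots> \<in> reciprocals"
    by (rule mult_mem_reciprocals[OF power_mem_reciprocals[OF assms(2)] n])
  finally have "(u * r) ^ n * inverse \<alpha> \<in> reciprocals" .
  moreover have "u * r \<in> reciprocals" using assms(2) r by (rule mult_mem_reciprocals)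
  ultimately show ?thesis unfolding radical_of_def by blast
qed

lemma radical_of_sum:
  fixes \<alpha> :: "'t::idom fract"
  assumes "finite I" "\<And>i. i \<in> I \<Longrightarrow> h i \<in> radical_of \<alpha>"
  shows "sum h I \<in> radical_of \<alpha>"
  using assms
proof (induction I)
  case empty
  have "(0::'t fract) ^ 1 * inverse \<alpha> \<in> reciprocals" by (simp add: reciprocals_closed)
  then show ?case by (auto simp: radical_of_def reciprocals_closed intro: exI[of _ 1])
next
  case (insert i I)
  then show ?case by (auto intro: radical_of_add)
qed

lemma radical_of_power:
  assumes "r \<in> reciprocals" "r ^ n \<in> radical_of \<alpha>"
  shows "r \<in> radical_of \<alpha>"
  using assms by (auto simp: radical_of_def power_mult[symmetric])

lemma radical_of_multiple:
  assumes "\<alpha> \<noteq> 0" "u \<in> reciprocals" "\<alpha> * u \<in> reciprocals"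
  shows "\<alpha> * u \<in> radical_of \<alpha>"
proof -
  have "(\<alpha> * u) ^ 1 * inverse \<alpha> = u" using assms(1) by simp
  then have "(\<alpha> * u) ^ 1 * inverse \<alpha> \<in> reciprocals" using assms(2) by (simp only:)
  with assms(3) show ?thesis unfolding radical_of_def by blast
qed

lemma sum_Fract_over_prod:
  fixes f :: "'i \<Rightarrow> 't::idom"
  assumes "finite S" "\<And>i. i \<in> S \<Longrightarrow> f i \<noteq> 0"
  shows "\<exists>s. Fract c 1 + (\<Sum>i\<in>S. Fract 1 (f i)) = Fract s (prod f S)"
  using assms
proof (induction S)
  case (insert i S)
  then obtain s where s: "Fract c 1 + (\<Sum>i\<in>S. Fract 1 (f i)) = Fract s (prod f S)" by auto
  have "Fract c 1 + (\<Sum>i\<in>insert i S. Fract 1 (f i)) = Fract s (prod f S) + Fract 1 (f i)"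
    using insert by (simp add: ac_simps flip: s)
  also have "\<dots> = Fract (s * f i + prod f S) (prod f (insert i S))"
    using insert by (simp add: prod_zero_iff mult.commute)
  finally show ?case by blast
qed auto

text \<open>
  Put \<open>\<alpha> = c + (\<Sum>i\<in>I. 1/f\<^sub>i)\<close> and \<open>f\<^sub>S = (\<Prod>i\<in>S. f\<^sub>i)\<close>. Downward induction on \<open>S \<subseteq> I\<close> shows that
  \<open>1/f\<^sub>S\<close> is in the radical of \<open>(\<alpha>)\<close>; the case \<open>S = {}\<close> is the claim. The partial sum over \<open>S\<close>
  is a fraction \<open>s/f\<^sub>S\<close> with \<open>s \<noteq> 0\<close>, so \<open>1/s\<close> is available and
  \<open>1/f\<^sub>S = 1/s * (\<alpha> - (\<Sum>i\<in>I - S. 1/f\<^sub>i))\<close>. Multiplying by \<open>1/f\<^sub>S\<close> once more turns the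
  summands outside \<open>S\<close> into multiples of \<open>1/f\<close> for the larger sets \<open>insert i S\<close>, which are covered
  by the induction hypothesis. So \<open>(1/f\<^sub>S)\<^sup>2\<close> is in the radical, and with it \<open>1/f\<^sub>S\<close>.
\<close>

lemma inverse_mem_reciprocals:
  fixes f :: "'i \<Rightarrow> 't::idom"
  assumes "finite I" and nz: "\<And>i. i \<in> I \<Longrightarrow> f i \<noteq> 0" and c: "Fract c 1 \<in> reciprocals"
    and subsums: "\<And>S. S \<subseteq> I \<Longrightarrow> Fract c 1 + (\<Sum>i\<in>S. Fract 1 (f i)) \<noteq> 0"
  shows "inverse (Fract c 1 + (\<Sum>i\<in>I. Fract 1 (f i))) \<in> reciprocals"
proof -
  define \<alpha> where "\<alpha> = Fract c 1 + (\<Sum>i\<in>I. Fract 1 (f i))"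
  have \<alpha>: "\<alpha> \<in> reciprocals" "\<alpha> \<noteq> 0"
    unfolding \<alpha>_def using nz c subsums[of I]
    by (auto intro!: reciprocals_closed sum_mem_reciprocals)
  have "S \<subseteq> I \<Longrightarrow> Fract 1 (prod f S) \<in> radical_of \<alpha>" for S
  proof (induction "card (I - S)" arbitrary: S rule: less_induct)
    case less
    have finS: "finite S" using less.prems \<open>finite I\<close> finite_subset by blast
    have fS: "prod f S \<noteq> 0" using less.prems nz finS by (auto simp: prod_zero_iff)
    obtain s where s: "Fract c 1 + (\<Sum>i\<in>S. Fract 1 (f i)) = Fract s (prod f S)"
      using sum_Fract_over_prod[of S f c] finS nz less.prems by blast
    have "s \<noteq> 0"
      using subsums[OF less.prems] s by (auto simp: fract_collapse)
    have step: "Fract 1 (prod f S) * Fract 1 (f i) \<in> radical_of \<alpha>" if "i \<in> I - S" for i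
    proof -
      have "Fract 1 (prod f (insert i S)) \<in> radical_of \<alpha>"
        using that less.prems \<open>finite I\<close>
        by (intro less.hyps psubset_card_mono) auto
      then show ?thesis using that finS by (simp add: mult.commute)
    qed
    have "\<alpha> = Fract s (prod f S) + (\<Sum>i\<in>I - S. Fract 1 (f i))"
      using sum.subset_diff[OF less.prems \<open>finite I\<close>, of "\<lambda>i. Fract 1 (f i)"] s
      by (simp add: \<alpha>_def ac_simps flip: s)
    moreover have "Fract 1 s * Fract s (prod f S) = Fract 1 (prod f S)"
      using \<open>s \<noteq> 0\<close> fS by (simp add: eq_fract)
    ultimately have "Fract 1 (prod f S) = Fract 1 s * (\<alpha> - (\<Sum>i\<in>I - S. Fract 1 (f i)))"
      by simp
    then have "Fract 1 (prod f S) ^ 2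
        = Fract 1 (prod f S) * (Fract 1 s * (\<alpha> - (\<Sum>i\<in>I - S. Fract 1 (f i))))"
      by (simp add: power2_eq_square)
    also have "\<dots> = \<alpha> * (Fract 1 (prod f S) * Fract 1 s)
        + - Fract 1 s * (\<Sum>i\<in>I - S. Fract 1 (prod f S) * Fract 1 (f i))"
    proof -
      have "p * (u * (\<alpha> - t)) = \<alpha> * (p * u) + - u * (p * t)" for p u t
        by (simp add: algebra_simps)
      then show ?thesis unfolding sum_distrib_left[symmetric] .
    qed
    also have "\<dots> \<in> radical_of \<alpha>"
    proof (rule radical_of_add)
      show "\<alpha> * (Fract 1 (prod f S) * Fract 1 s) \<in> radical_of \<alpha>"
        using \<alpha> \<open>s \<noteq> 0\<close> fS by (intro radical_of_multiple reciprocals_closed)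
      have "(\<Sum>i\<in>I - S. Fract 1 (prod f S) * Fract 1 (f i)) \<in> radical_of \<alpha>"
        using \<open>finite I\<close> step by (intro radical_of_sum) auto
      then show "- Fract 1 s * (\<Sum>i\<in>I - S. Fract 1 (prod f S) * Fract 1 (f i)) \<in> radical_of \<alpha>"
        using \<open>s \<noteq> 0\<close> by (intro radical_of_mult reciprocals_closed)
    qed
    finally show ?case
      by (rule radical_of_power[rotated]) (use fS in \<open>rule reciprocals_closed\<close>)
  qed
  from this[of "{}"] have "1 \<in> radical_of \<alpha>" by (simp add: fract_collapse)
  then show ?thesis by (simp add: radical_of_def \<alpha>_def)
qed

section \<open>Domains with a degree\<close>

locale degree_domain =
  fixes deg :: "'t::idom \<Rightarrow> nat"
  assumes deg_zero: "deg 0 = 0"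
    and deg_mult: "f \<noteq> 0 \<Longrightarrow> g \<noteq> 0 \<Longrightarrow> deg (f * g) = deg f + deg g"
    and deg_add_le: "deg (f + g) \<le> max (deg f) (deg g)"
    and deg_0_unit: "f \<noteq> 0 \<Longrightarrow> deg f = 0 \<Longrightarrow> f dvd 1"
begin

text \<open>
  The fraction \<open>a/b\<close> has order \<open>deg b - deg a\<close> at infinity. Only lower bounds on the order are ever
  used, and the predicate gives \<open>0\<close> the order infinity.
\<close>

definition order_ge :: "nat \<Rightarrow> 't fract \<Rightarrow> bool" where
  "order_ge k x \<longleftrightarrow> (\<exists>a b. b \<noteq> 0 \<and> x = Fract a b \<and> (a = 0 \<or> deg a + k \<le> deg b))"

lemma deg_one: "deg 1 = 0"
  using deg_mult[of 1 1] by simp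

lemma deg_uminus: "deg (- f) = deg f"
proof -
  have "deg (- 1) = 0" using deg_mult[of "- 1" "- 1"] deg_one by simp
  then show ?thesis using deg_mult[of "- 1" f] by (cases "f = 0") auto
qed

text \<open>
  The bound can be read off any representation of a nonzero fraction, because cross-multiplying
  changes numerator and denominator degree by the same amount.
\<close>

lemma order_ge_Fract_iff:
  assumes "a \<noteq> 0" "b \<noteq> 0"
  shows "order_ge k (Fract a b) \<longleftrightarrow> deg a + k \<le> deg b"
proof
  assume "order_ge k (Fract a b)"
  then obtain a' b' where *: "b' \<noteq> 0" "Fract a b = Fract a' b'" "a' = 0 \<or> deg a' + k \<le> deg b'"
    by (auto simp: order_ge_def)
  then have eq: "a * b' = a' * b" using assms by (simp add: eq_fract)
  then have "a' \<noteq> 0" using * assms by auto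
  then have "deg a + deg b' = deg a' + deg b" "deg a' + k \<le> deg b'"
    using * assms deg_mult[of a b'] deg_mult[of a' b] eq by auto
  then show "deg a + k \<le> deg b" by linarith
qed (use assms in \<open>auto simp: order_ge_def\<close>)

lemma order_ge_zero: "order_ge k 0"
  unfolding order_ge_def Zero_fract_def by (intro exI[of _ 0] exI[of _ 1]) simp

lemma order_ge_mult:
  assumes "order_ge k x" "order_ge l y"
  shows "order_ge (k + l) (x * y)"
proof -
  from assms obtain a b a' b' where *: "b \<noteq> 0" "x = Fract a b" "a = 0 \<or> deg a + k \<le> deg b"
    "b' \<noteq> 0" "y = Fract a' b'" "a' = 0 \<or> deg a' + l \<le> deg b'"
    unfolding order_ge_def by blast
  then have "a * a' = 0 \<or> deg (a * a') + (k + l) \<le> deg (b * b')"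
    by (cases "a = 0 \<or> a' = 0") (auto simp: deg_mult)
  with * show ?thesis
    unfolding order_ge_def by (intro exI[of _ "a * a'"] exI[of _ "b * b'"]) simp
qed

lemma order_ge_add:
  assumes "order_ge k x" "order_ge k y"
  shows "order_ge k (x + y)"
proof -
  from assms obtain a b a' b' where *: "b \<noteq> 0" "x = Fract a b" "a = 0 \<or> deg a + k \<le> deg b"
    "b' \<noteq> 0" "y = Fract a' b'" "a' = 0 \<or> deg a' + k \<le> deg b'"
    unfolding order_ge_def by blast
  show ?thesis
  proof (cases "a = 0 \<or> a' = 0")
    case True
    then have "x = 0 \<or> y = 0" using * by (auto simp: fract_collapse)
    then show ?thesis using assms by auto
  next
    case False
    then have "deg (a * b' + a' * b) + k \<le> deg (b * b')"
      using deg_add_le[of "a * b'" "a' * b"] * by (auto simp: deg_mult)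
    with * show ?thesis
      unfolding order_ge_def
      by (intro exI[of _ "a * b' + a' * b"] exI[of _ "b * b'"]) simp
  qed
qed

lemma order_ge_sum_list:
  assumes "\<And>g. g \<in> set gs \<Longrightarrow> g \<noteq> 0 \<and> deg g > 0"
  shows "order_ge 1 (\<Sum>g\<leftarrow>gs. Fract 1 g)"
  using assms
  by (induction gs) (auto intro!: order_ge_zero order_ge_add simp: order_ge_Fract_iff deg_one Suc_le_eq)

text \<open>
  Elements of degree \<open>0\<close> are units, so their reciprocals are again constants and can be added up.
\<close>

lemma constant_plus_positive_part:
  assumes "r \<in> reciprocals"
  obtains c gs where "deg c = 0" "\<And>g. g \<in> set gs \<Longrightarrow> g \<noteq> 0 \<and> deg g > 0"
    "r = Fract c 1 + (\<Sum>g\<leftarrow>gs. Fract 1 g)"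
proof -
  obtain fs where "0 \<notin> set fs" "r = (\<Sum>f\<leftarrow>fs. Fract 1 f)"
    using reciprocals_eq_sum_list[OF assms] by blast
  moreover have "\<exists>c gs. deg c = 0 \<and> (\<forall>g\<in>set gs. g \<noteq> 0 \<and> deg g > 0) \<and>
      (\<Sum>f\<leftarrow>fs. Fract 1 f) = Fract c 1 + (\<Sum>g\<leftarrow>gs. Fract 1 g)" if "0 \<notin> set fs" for fs
    using that
  proof (induction fs)
    case Nil
    show ?case by (intro exI[of _ 0] exI[of _ "[]"]) (simp add: deg_zero fract_collapse)
  next
    case (Cons f fs)
    then obtain c gs where IH: "deg c = 0" "\<forall>g\<in>set gs. g \<noteq> 0 \<and> deg g > 0"
      "(\<Sum>f\<leftarrow>fs. Fract 1 f) = Fract c 1 + (\<Sum>g\<leftarrow>gs. Fract 1 g)" by auto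
    show ?case
    proof (cases "deg f = 0")
      case False
      then show ?thesis
        using IH Cons.prems
        by (intro exI[of _ c] exI[of _ "f # gs"]) (auto simp: add.left_commute)
    next
      case True
      then obtain g where g: "f * g = 1" using deg_0_unit[of f] Cons.prems by (auto simp: dvd_def)
      then have "Fract 1 f = Fract g 1" using Cons.prems by (auto simp: eq_fract mult.commute)
      moreover have "deg g = 0"
        using deg_mult[of f g] g deg_one Cons.prems by (cases "g = 0") auto
      then have "deg (g + c) = 0" using deg_add_le[of g c] IH by simp
      ultimately show ?thesis
        using IH by (intro exI[of _ "g + c"] exI[of _ gs]) (auto simp: add.assoc[symmetric])
    qed
  qed
  ultimately show thesis using that by blast
qed

text \<open>
  Locality. A constant \<open>c \<noteq> 0\<close> has order \<open>0\<close>, so no sum of reciprocals of elements of positive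
  degree cancels it: all partial sums are nonzero, and the whole sum can be inverted.
\<close>

lemma unit_or_order_ge_1:
  assumes "r \<in> reciprocals"
  shows "inverse r \<in> reciprocals \<or> order_ge 1 r"
proof -
  obtain c gs where c: "deg c = 0" and gs: "\<And>g. g \<in> set gs \<Longrightarrow> g \<noteq> 0 \<and> deg g > 0"
    and r: "r = Fract c 1 + (\<Sum>g\<leftarrow>gs. Fract 1 g)"
    using constant_plus_positive_part[OF assms] by blast
  show ?thesis
  proof (cases "c = 0")
    case True
    then show ?thesis using r order_ge_sum_list[of gs] gs by (simp add: fract_collapse)
  next
    case False
    obtain e where e: "c * e = 1" using deg_0_unit[OF False c] by (auto simp: dvd_def)
    then have "e \<noteq> 0" by auto
    have "Fract c 1 = Fract 1 e" using e \<open>e \<noteq> 0\<close> by (simp add: eq_fract)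
    then have c_mem: "Fract c 1 \<in> reciprocals" using \<open>e \<noteq> 0\<close> by (simp add: reciprocals_closed)
    have "Fract c 1 + (\<Sum>i\<in>S. Fract 1 (gs ! i)) \<noteq> 0" if S: "S \<subseteq> {..<length gs}" for S
    proof
      assume "Fract c 1 + (\<Sum>i\<in>S. Fract 1 (gs ! i)) = 0"
      then have "(\<Sum>i\<in>S. Fract 1 (gs ! i)) = Fract (- c) 1"
        by (metis add_eq_0_iff minus_fract)
      moreover have "order_ge 1 (\<Sum>i\<in>S. Fract 1 (gs ! i))"
        using S
      proof (induction S rule: infinite_finite_induct)
        case (insert i S)
        then have "gs ! i \<in> set gs" by simp
        with insert gs show ?case
          by (auto intro!: order_ge_add simp: order_ge_Fract_iff deg_one Suc_le_eq)
      qed (auto intro: order_ge_zero)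
      ultimately show False
        using False order_ge_Fract_iff[of "- c" 1 1] by (simp add: deg_one)
    qed
    then have "inverse (Fract c 1 + (\<Sum>i<length gs. Fract 1 (gs ! i))) \<in> reciprocals"
      using gs c_mem by (intro inverse_mem_reciprocals) auto
    then show ?thesis
      by (simp add: r sum_list_sum_nth atLeast0LessThan)
  qed
qed

text \<open>
  Two nonunits would have a product of order at least \<open>2\<close>, but \<open>1/l\<close> has order \<open>1\<close>.
\<close>

lemma reciprocal_linear_irreducible:
  assumes "l \<noteq> 0" "deg l = 1" "r \<in> reciprocals" "s \<in> reciprocals" "Fract 1 l = r * s"
  shows "inverse r \<in> reciprocals \<or> inverse s \<in> reciprocals"
proof (rule ccontr)
  assume "\<not> ?thesis"
  then have "order_ge (1 + 1) (r * s)"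
    using unit_or_order_ge_1 assms by (intro order_ge_mult) blast+
  with assms show False using order_ge_Fract_iff[of 1 l "1 + 1"] by (simp add: deg_one)
qed

text \<open>
  The hypothesis says that \<open>x\<close> and \<open>y\<close> have degree \<open>1\<close> and are linearly independent over the
  constants modulo elements of lower degree. Independence is what keeps \<open>1/(x + y)\<close> from dividing
  \<open>1/x\<close> or \<open>1/y\<close>.
\<close>

theorem not_factorial_domain_reciprocal_complement:
  assumes indep: "\<And>a b. deg a = 0 \<Longrightarrow> deg b = 0 \<Longrightarrow> a \<noteq> 0 \<or> b \<noteq> 0 \<Longrightarrow>
    a * x + b * y \<noteq> 0 \<and> deg (a * x + b * y) = 1"
  shows "\<not> factorial_domain (reciprocal_complement :: 't fract ring)"
proof
  let ?R = "reciprocal_complement :: 't fract ring"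
  assume "factorial_domain ?R"
  then interpret factorial_domain ?R .
  define l where "l = x + y"
  have x: "x \<noteq> 0" "deg x = 1" using indep[of 1 0] by (auto simp: deg_one deg_zero)
  have y: "y \<noteq> 0" "deg y = 1" using indep[of 0 1] by (auto simp: deg_one deg_zero)
  have l: "l \<noteq> 0" "deg l = 1" using indep[of 1 1] by (auto simp: deg_one l_def)
  have not_dvd: "\<not> Fract 1 l divides\<^bsub>?R\<^esub> Fract 1 z"
    if z: "z \<noteq> 0" "deg z = 1" and indep_z: "\<And>c. deg c = 0 \<Longrightarrow> l - c * z \<noteq> 0 \<and> deg (l - c * z) = 1"
    for z
  proof
    assume "Fract 1 l divides\<^bsub>?R\<^esub> Fract 1 z"
    then obtain r where r: "r \<in> reciprocals" "Fract 1 z = Fract 1 l * r"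
      by (auto simp: factor_def)
    have "r = Fract l 1 * (Fract 1 l * r)"
    proof -
      have "Fract l 1 * Fract 1 l = 1" using l by (simp add: One_fract_def eq_fract)
      then show ?thesis by (simp flip: mult.assoc)
    qed
    then have r_eq: "r = Fract l z" by (simp flip: r(2))
    obtain c gs where c: "deg c = 0" and gs: "\<And>g. g \<in> set gs \<Longrightarrow> g \<noteq> 0 \<and> deg g > 0"
      and rc: "r = Fract c 1 + (\<Sum>g\<leftarrow>gs. Fract 1 g)"
      using constant_plus_positive_part[OF r(1)] by blast
    \<comment> \<open>The part of \<open>l/z\<close> of order at least 1 would be a fraction of degree 1 over degree 1.\<close>
    have "(\<Sum>g\<leftarrow>gs. Fract 1 g) = Fract l z - Fract c 1" using rc r_eq by simp
    also have "\<dots> = Fract (l - c * z) z" using z by simp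
    finally have "order_ge 1 (Fract (l - c * z) z)" using order_ge_sum_list[of gs] gs by simp
    then show False using order_ge_Fract_iff[of "l - c * z" z 1] indep_z[OF c] z by simp
  qed
  have deg_1_minus: "deg (1 - c) = 0" if "deg c = 0" for c
    using deg_add_le[of 1 "- c"] that by (simp add: deg_one deg_uminus)
  have "\<not> Fract 1 l divides\<^bsub>?R\<^esub> Fract 1 x"
  proof (rule not_dvd[OF x])
    fix c assume "deg c = 0"
    then show "l - c * x \<noteq> 0 \<and> deg (l - c * x) = 1"
      using indep[of "1 - c" 1] deg_1_minus by (simp add: l_def deg_one algebra_simps)
  qed
  moreover have "\<not> Fract 1 l divides\<^bsub>?R\<^esub> Fract 1 y"
  proof (rule not_dvd[OF y])
    fix c assume "deg c = 0"
    then show "l - c * y \<noteq> 0 \<and> deg (l - c * y) = 1"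
      using indep[of 1 "1 - c"] deg_1_minus by (simp add: l_def deg_one algebra_simps)
  qed
  moreover have "Fract 1 l divides\<^bsub>?R\<^esub> Fract 1 x \<or> Fract 1 l divides\<^bsub>?R\<^esub> Fract 1 y"
  proof -
    have nz: "Fract 1 z \<in> reciprocals - {0}" if "z \<noteq> 0" for z :: 't
      using that by (auto simp: reciprocals_closed Zero_fract_def eq_fract)
    have unitI: "r \<in> Units ?R" if "r \<in> reciprocals" "inverse r \<in> reciprocals" "r \<noteq> 0" for r
      using that unfolding Units_def by (auto intro!: bexI[of _ "inverse r"])
    have "ring_irreducible\<^bsub>?R\<^esub> (Fract 1 l)"
    proof (rule ring_irreducibleI)
      show "Fract 1 l \<in> carrier ?R - {\<zero>\<^bsub>?R\<^esub>}" using nz l by simp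
      show "Fract 1 l \<notin> Units ?R"
      proof
        assume "Fract 1 l \<in> Units ?R"
        then have "Fract 1 l divides\<^bsub>?R\<^esub> Fract 1 x"
          using nz[OF x(1)] nz[OF l(1)] by (intro unit_divides) auto
        with \<open>\<not> Fract 1 l divides\<^bsub>?R\<^esub> Fract 1 x\<close> show False ..
      qed
      fix r s assume rs: "r \<in> carrier ?R" "s \<in> carrier ?R" "Fract 1 l = r \<otimes>\<^bsub>?R\<^esub> s"
      then have "inverse r \<in> reciprocals \<or> inverse s \<in> reciprocals"
        using reciprocal_linear_irreducible[OF l] by simp
      moreover have "r \<noteq> 0" "s \<noteq> 0" using rs nz[OF l(1)] by auto
      ultimately show "r \<in> Units ?R \<or> s \<in> Units ?R" using rs unitI by blast
    qed
    then have "Divisibility.prime (mult_of ?R) (Fract 1 l)"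
      using nz[OF l(1)] ring_irreducibleE(3)[of "Fract 1 l"]
      by (intro factorial_monoid.irreducible_prime[OF factorial_monoid_axioms]) auto
    moreover have "Fract 1 l divides\<^bsub>mult_of ?R\<^esub> (Fract 1 x * Fract 1 y)"
    proof -
      have "Fract 1 x * Fract 1 y = Fract 1 l * (Fract 1 x + Fract 1 y)"
        using x y l by (simp add: eq_fract) (simp add: l_def algebra_simps)
      then have "Fract 1 l divides\<^bsub>?R\<^esub> (Fract 1 x * Fract 1 y)"
        using x y by (auto simp: factor_def intro!: bexI[of _ "Fract 1 x + Fract 1 y"] reciprocals_closed)
      then show ?thesis
        using nz[OF l(1)] nz[of "x * y"] x y by (intro divides_imp_divides_mult) auto
    qed
    ultimately have "Fract 1 l divides\<^bsub>mult_of ?R\<^esub> Fract 1 x \<or> Fract 1 l divides\<^bsub>mult_of ?R\<^esub> Fract 1 y"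
      using nz x y by (auto simp: Divisibility.prime_def)
    then show ?thesis by (elim disj_forward) (erule divides_mult_imp_divides)+
  qed
  ultimately show False by blast
qed

end

section \<open>The total degree of a polynomial\<close>

definition exponent_sum :: "('n::finite \<Rightarrow>\<^sub>0 nat) \<Rightarrow> nat" where
  "exponent_sum m = (\<Sum>i\<in>UNIV. Poly_Mapping.lookup m i)"

lemma exponent_sum_add: "exponent_sum (m + n) = exponent_sum m + exponent_sum n"
  by (simp add: exponent_sum_def lookup_add sum.distrib)

lemma exponent_sum_eq_0_iff: "exponent_sum m = 0 \<longleftrightarrow> m = 0"
  by (auto simp: exponent_sum_def intro: poly_mapping_eqI)

lemma exponent_sum_single: "exponent_sum (Poly_Mapping.single i k) = k"
  by (simp add: exponent_sum_def lookup_single when_def)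

text \<open>
  The polynomial \<open>p(t X\<^sub>1, \<dots>, t X\<^sub>n)\<close> in the new variable \<open>t\<close>, whose coefficients are the homogeneous
  components of \<open>p\<close>. Since substitution is multiplicative, the additivity of the total degree is
  inherited from the degree in \<open>t\<close> over the integral domain of polynomials in \<open>X\<^sub>1, \<dots>, X\<^sub>n\<close>.
\<close>

definition homogenize :: "('n::finite, 'k::comm_ring_1) mpoly \<Rightarrow> ('n, 'k) mpoly poly" where
  "homogenize p = (\<Sum>m\<in>Poly_Mapping.keys p.
     Polynomial.monom (Poly_Mapping.single m (Poly_Mapping.lookup p m)) (exponent_sum m))"

lemma homogenize_superset:
  assumes "finite A" "Poly_Mapping.keys p \<subseteq> A"
  shows "homogenize p = (\<Sum>m\<in>A.
     Polynomial.monom (Poly_Mapping.single m (Poly_Mapping.lookup p m)) (exponent_sum m))"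
  unfolding homogenize_def
  by (rule sum.mono_neutral_left) (use assms in \<open>auto simp: in_keys_iff\<close>)

lemma homogenize_add: "homogenize (p + q) = homogenize p + homogenize q"
proof -
  let ?A = "Poly_Mapping.keys p \<union> Poly_Mapping.keys q"
  have "homogenize r = (\<Sum>m\<in>?A.
     Polynomial.monom (Poly_Mapping.single m (Poly_Mapping.lookup r m)) (exponent_sum m))"
    if "r \<in> {p, q, p + q}" for r
    using that keys_add[of p q] by (intro homogenize_superset) auto
  then show ?thesis
    by (simp add: lookup_add single_add add_monom[symmetric] sum.distrib)
qed

lemma homogenize_single:
  "homogenize (Poly_Mapping.single m a) = Polynomial.monom (Poly_Mapping.single m a) (exponent_sum m)"
  by (subst homogenize_superset[of "{m}"]) auto

lemma homogenize_zero: "homogenize 0 = 0"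
  by (simp add: homogenize_def)

lemma homogenize_sum: "homogenize (sum h A) = (\<Sum>x\<in>A. homogenize (h x))"
  by (induction A rule: infinite_finite_induct) (auto simp: homogenize_zero homogenize_add)

lemma poly_mapping_eq_sum_single:
  "(\<Sum>m\<in>Poly_Mapping.keys p. Poly_Mapping.single m (Poly_Mapping.lookup p m)) = p"
  by (rule poly_mapping_eqI)
    (auto simp: lookup_sum lookup_single when_def in_keys_iff)

text \<open>
  By bilinearity this only has to be seen on monomials, where it is additivity of the exponent sum.
\<close>

lemma homogenize_mult: "homogenize (p * q) = homogenize p * homogenize q"
proof -
  let ?s = "\<lambda>r m. Poly_Mapping.single m (Poly_Mapping.lookup r m)"
  have "p * q = (\<Sum>m\<in>Poly_Mapping.keys p. \<Sum>n\<in>Poly_Mapping.keys q. ?s p m * ?s q n)"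
    by (simp only: sum_product[symmetric] poly_mapping_eq_sum_single)
  then have "homogenize (p * q) =
      (\<Sum>m\<in>Poly_Mapping.keys p. \<Sum>n\<in>Poly_Mapping.keys q. homogenize (?s p m) * homogenize (?s q n))"
    by (simp add: homogenize_sum mult_single homogenize_single mult_monom exponent_sum_add)
  also have "\<dots> = homogenize p * homogenize q"
    by (simp only: sum_product[symmetric] homogenize_sum[symmetric] poly_mapping_eq_sum_single)
  finally show ?thesis .
qed

lemma lookup_coeff_homogenize:
  "Poly_Mapping.lookup (coeff (homogenize p) (exponent_sum m)) m = Poly_Mapping.lookup p m"
proof -
  have "Poly_Mapping.lookup (coeff (homogenize p) (exponent_sum m)) m = (\<Sum>n\<in>Poly_Mapping.keys p. if n = m then Poly_Mapping.lookup p n else 0)"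
    unfolding homogenize_def coeff_sum lookup_sum
    by (intro sum.cong) (auto simp: lookup_single when_def)
  then show ?thesis by (auto simp: in_keys_iff)
qed

definition total_degree :: "('n::finite, 'k::comm_ring_1) mpoly \<Rightarrow> nat" where
  "total_degree p = degree (homogenize p)"

lemma exponent_sum_le_total_degree: "m \<in> Poly_Mapping.keys p \<Longrightarrow> exponent_sum m \<le> total_degree p"
  unfolding total_degree_def
  by (rule le_degree) (metis in_keys_iff lookup_coeff_homogenize lookup_zero)

lemma homogenize_eq_0_iff: "homogenize p = 0 \<longleftrightarrow> p = 0"
  by (metis coeff_0 homogenize_zero lookup_coeff_homogenize lookup_zero poly_mapping_eqI)

lemma total_degree_single: "a \<noteq> 0 \<Longrightarrow> total_degree (Poly_Mapping.single m a) = exponent_sum m"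
  unfolding total_degree_def homogenize_single
  by (rule degree_monom_eq) (metis lookup_single_eq lookup_zero)

lemma total_degree_0_constant:
  assumes "total_degree p = 0"
  shows "\<exists>a. p = Poly_Mapping.single 0 a"
proof (intro exI poly_mapping_eqI)
  fix m
  show "Poly_Mapping.lookup p m = Poly_Mapping.lookup (Poly_Mapping.single 0 (Poly_Mapping.lookup p 0)) m"
    using exponent_sum_le_total_degree[of m p] assms exponent_sum_eq_0_iff[of m]
    by (cases "m = 0") (auto simp: in_keys_iff lookup_single)
qed

interpretation total_degree: degree_domain
  "total_degree :: ('n::{finite,linorder}, 'k::field) mpoly \<Rightarrow> nat"
proof
  fix p q :: "('n, 'k) mpoly"
  show "total_degree (0 :: ('n, 'k) mpoly) = 0"
    by (simp add: total_degree_def homogenize_zero)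
  show "total_degree (p * q) = total_degree p + total_degree q" if "p \<noteq> 0" "q \<noteq> 0"
    using that
    by (simp add: total_degree_def homogenize_mult degree_mult_eq homogenize_eq_0_iff)
  show "total_degree (p + q) \<le> max (total_degree p) (total_degree q)"
    by (simp add: total_degree_def homogenize_add degree_add_le_max)
  show "p dvd 1" if nz: "p \<noteq> 0" and deg0: "total_degree p = 0"
  proof -
    obtain a where a: "p = Poly_Mapping.single 0 a" using total_degree_0_constant[OF deg0] by blast
    with nz have "a \<noteq> 0" by auto
    then have "p * Poly_Mapping.single 0 (inverse a) = 1" by (simp add: a mult_single)
    then show ?thesis by (metis dvdI)
  qed
qed

theorem mainTheorem7:
  assumes "CARD('n::{finite,linorder}) \<ge> 2"
  shows "\<not> factorial_domain (reciprocal_complement :: ('n, 'k::field) mpoly fract ring)"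
proof -
  obtain i j :: 'n where "i \<noteq> j"
    using assms card_le_Suc0_iff_eq[of "UNIV :: 'n set"] by fastforce
  define x y :: "('n, 'k) mpoly"
    where "x = Poly_Mapping.single (Poly_Mapping.single i 1) 1"
      and "y = Poly_Mapping.single (Poly_Mapping.single j 1) 1"
  have deg_xy: "total_degree x = 1" "total_degree y = 1"
    by (simp_all add: x_def y_def total_degree_single exponent_sum_single)
  show ?thesis
  proof (rule total_degree.not_factorial_domain_reciprocal_complement)
    fix a b :: "('n, 'k) mpoly"
    assume ab: "total_degree a = 0" "total_degree b = 0" "a \<noteq> 0 \<or> b \<noteq> 0"
    obtain s t where st: "a = Poly_Mapping.single 0 s" "b = Poly_Mapping.single 0 t"
      using ab total_degree_0_constant by metis
    define p where "p = a * x + b * y"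
    have p: "p = Poly_Mapping.single (Poly_Mapping.single i 1) s
        + Poly_Mapping.single (Poly_Mapping.single j 1) t"
      by (simp add: p_def x_def y_def st mult_single)
    have "Poly_Mapping.single i (1::nat) \<noteq> Poly_Mapping.single j 1"
      using \<open>i \<noteq> j\<close> by (metis lookup_single_eq lookup_single_not_eq one_neq_zero)
    then have lookups: "Poly_Mapping.lookup p (Poly_Mapping.single i 1) = s"
      "Poly_Mapping.lookup p (Poly_Mapping.single j 1) = t"
      by (auto simp: p lookup_add lookup_single when_def)
    moreover have "s \<noteq> 0 \<or> t \<noteq> 0" using ab(3) st by auto
    ultimately obtain k where "Poly_Mapping.single k 1 \<in> Poly_Mapping.keys p"
      by (auto simp: in_keys_iff)
    then have "p \<noteq> 0" "1 \<le> total_degree p"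
      using exponent_sum_le_total_degree[of "Poly_Mapping.single k 1" p] by (auto simp: exponent_sum_single)
    moreover have le: "total_degree (c * z) \<le> 1" if "total_degree c = 0" "total_degree z = 1"
      for c z :: "('n, 'k) mpoly"
      using that total_degree.deg_mult[of c z]
      by (cases "c = 0 \<or> z = 0") (auto simp: total_degree.deg_zero)
    then have "total_degree p \<le> 1"
      unfolding p_def
      by (intro order_trans[OF total_degree.deg_add_le] max.boundedI le ab deg_xy)
    ultimately show "a * x + b * y \<noteq> 0 \<and> total_degree (a * x + b * y) = 1"
      by (simp add: p_def)
  qed
qed

end
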